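(* Let $a,b,c\in\mathbb{R}$ with $a\neq 0$, let $g:\mathbb{R}\to\mathbb{R}$, $g(x)=ax^2+bx+c$, let $\delta:=b^2-4ac-2b-7$, and assume that $\delta>0$. Let $(x,y,z)$ be a representative of the 3-cycle $\mathcal{C}_{\langle\delta\rangle}$ of the map $x_{t+1}=g(x_t)$, and let $r=\frac{z-y}{y-x}$ be the ratio between successive distances. The following statements are equivalent: (i) $\mathcal{C}_{\langle\delta\rangle}$ is asymptotically stable; (ii) $r\in(-1.801..,-1.713..]\cup(-0.445..,-0.416..]\cup(1.246..,1.401..]$.
   Context: The two dots after a decimal number, as in $1.246..$, indicate that only the first digits of the decimal expansion of the number are displayed. A 3-cycle of the map $x_{t+1}=g(x_t)$ is the class, modulo cyclic permutation, of an ordered triple $(x,y,z)$ of pairwise distinct real numbers with $g(x)=y$, $g(y)=z$, $g(z)=x$; any such triple is called a representative of the 3-cycle, and $x,y,z$ are its points. For $\beta\in\mathbb{R}$ let $Q_\beta(X)=X^3+(1-\beta)X^2-(2+\beta)X-1$. All roots of $Q_\beta$ are real, distinct and nonzero; they are denoted $q^{\langle\beta\rangle}_1<q^{\langle\beta\rangle}_2<q^{\langle\beta\rangle}_3$. For $\delta>0$ the map has exactly two 3-cycles; $\mathcal{C}_{\langle\delta\rangle}$ is the one whose points are $\frac{-b+\sqrt{\delta}+1}{2a}+\frac{1}{a q^{\langle\sqrt{\delta}\rangle}_i}$, $i\in\{1,2,3\}$. Write $g^{(n)}$ for the $n$-th iterate of $g$. A 3-cycle is stable if one (equivalently, any) of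 its points $x$ is a Lyapunov stable fixed point of $g^{(3)}$: for every $\varepsilon>0$ there is $\eta>0$ such that $|x_0-x|<\eta$ implies $|g^{(3t)}(x_0)-x|<\varepsilon$ for all $t\in\mathbb{N}$. It is asymptotically stable if it is stable and there is $\gamma>0$ such that $|x_0-x|<\gamma$ implies $\lim_{t\to\infty}g^{(3t)}(x_0)=x$. *)

theory Defs
  imports Complex_Main "HOL-Computational_Algebra.Polynomial"
begin

definition is_rep3 :: "(real \<Rightarrow> real) \<Rightarrow> real \<times> real \<times> real \<Rightarrow> bool" where
  "is_rep3 g = (\<lambda>(x, y, z). x \<noteq> y \<and> y \<noteq> z \<and> z \<noteq> x \<and> g x = y \<and> g y = z \<and> g z = x)"

definition cyclic_class :: "real \<times> real \<times> real \<Rightarrow> (real \<times> real \<times> real) set" where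
  "cyclic_class = (\<lambda>(x, y, z). {(x, y, z), (y, z, x), (z, x, y)})"

text \<open>A 3-cycle is a class of triples; its elements are its representatives.\<close>

definition is_three_cycle :: "(real \<Rightarrow> real) \<Rightarrow> (real \<times> real \<times> real) set \<Rightarrow> bool" where
  "is_three_cycle g C \<longleftrightarrow> (\<exists>t. is_rep3 g t \<and> C = cyclic_class t)"

definition cycle_points :: "(real \<times> real \<times> real) set \<Rightarrow> real set" where
  "cycle_points C = (\<Union>(x, y, z)\<in>C. {x, y, z})"

definition lyapunov_stable3 :: "(real \<Rightarrow> real) \<Rightarrow> real \<Rightarrow> bool" where
  "lyapunov_stable3 g x \<longleftrightarrow>
     (g ^^ 3) x = x \<and>
     (\<forall>\<epsilon>>0. \<exists>\<eta>>0. \<forall>x0. \<bar>x0 - x\<bar> < \<eta> \<longrightarrow> (\<forall>t. \<bar>(g ^^ (3 * t)) x0 - x\<bar> < \<epsilon>))"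

definition asymptotically_stable_cycle ::
    "(real \<Rightarrow> real) \<Rightarrow> (real \<times> real \<times> real) set \<Rightarrow> bool" where
  "asymptotically_stable_cycle g C \<longleftrightarrow>
     (\<exists>x\<in>cycle_points C. lyapunov_stable3 g x \<and>
        (\<exists>\<gamma>>0. \<forall>x0. \<bar>x0 - x\<bar> < \<gamma> \<longrightarrow> (\<lambda>t. (g ^^ (3 * t)) x0) \<longlonglongrightarrow> x))"

definition quad :: "real \<Rightarrow> real \<Rightarrow> real \<Rightarrow> real \<Rightarrow> real" where
  "quad a b c x = a * x\<^sup>2 + b * x + c"

definition delta :: "real \<Rightarrow> real \<Rightarrow> real \<Rightarrow> real" where
  "delta a b c = b\<^sup>2 - 4 * a * c - 2 * b - 7"

definition Q :: "real \<Rightarrow> real poly" where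
  "Q \<beta> = [:-1, -(2 + \<beta>), 1 - \<beta>, 1:]"

text \<open>The \<open>i\<close>-th smallest root of \<open>Q \<beta>\<close>, for \<open>i \<in> {1, 2, 3}\<close>.\<close>

definition q :: "real \<Rightarrow> nat \<Rightarrow> real" where
  "q \<beta> i = sorted_list_of_set {x. poly (Q \<beta>) x = 0} ! (i - 1)"

text \<open>The 3-cycle \<open>\<C>\<^sub>\<langle>\<^sub>\<delta>\<^sub>\<rangle>\<close>; meaningful for \<open>a \<noteq> 0\<close> and \<open>\<delta> > 0\<close>.\<close>

definition C_delta :: "real \<Rightarrow> real \<Rightarrow> real \<Rightarrow> (real \<times> real \<times> real) set" where
  "C_delta a b c = (THE C. is_three_cycle (quad a b c) C \<and>
     cycle_points C =
       {(- b + sqrt (delta a b c) + 1) / (2 * a) + 1 / (a * q (sqrt (delta a b c)) i) | i. i \<in> {1, 2, 3}})"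

text \<open>\<open>digits3 u d\<close> renders ``\<open>u\<close> is the number written \<open>d..\<close>'', where \<open>d\<close> displays three
  decimals: cutting off the decimal expansion of \<open>u\<close> after three decimals (i.e. truncating
  \<open>\<bar>u\<bar>\<close> and keeping the sign) gives \<open>d\<close>. So \<open>-1.801..\<close> lies in \<open>(-1.802, -1.801]\<close>.\<close>

definition digits3 :: "real \<Rightarrow> real \<Rightarrow> bool" where
  "digits3 u d \<longleftrightarrow> sgn u * (of_int \<lfloor>1000 * \<bar>u\<bar>\<rfloor> / 1000) = d"

end

theory Submission
  imports Defs
begin

text \<open>
  Write \<open>\<beta> = \<surd>\<delta>\<close>. The roots of \<open>Q \<beta>\<close> form an orbit of \<open>r \<mapsto> - (r + 1) / r\<close>, the rule by which
  the ratio of successive distances evolves along a 3-cycle, and the point attached to the root \<open>r\<close>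
  is the one from which that ratio equals \<open>r\<close>. So \<open>r\<close> is a root of \<open>Q \<beta>\<close>, that is
  \<open>\<beta> = r - 1 / r - 1 / (r + 1)\<close>, which is strictly increasing on each of the intervals
  \<open>r < -1\<close>, \<open>-1 < r < 0\<close> and \<open>r > 0\<close>. The multiplier of the cycle is \<open>1 - (\<beta>\<^sup>3 + \<beta>\<^sup>2 + 7 \<beta>) < 1\<close>.
  The cycle is asymptotically stable iff the multiplier is at least \<open>-1\<close>: at \<open>-1\<close> the cubic term of
  the second return map is contracting. Hence stability means \<open>0 < \<beta> \<le> \<beta>\<^sub>0\<close> with
  \<open>\<beta>\<^sub>0\<^sup>3 + \<beta>\<^sub>0\<^sup>2 + 7 \<beta>\<^sub>0 = 2\<close>, and the six end points are the solutions \<open>r\<close> for \<open>\<beta> = 0\<close> and \<open>\<beta> = \<beta>\<^sub>0\<close>.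
\<close>

definition stable_at_zero :: "(real \<Rightarrow> real) \<Rightarrow> bool" where
  "stable_at_zero F \<longleftrightarrow> (\<forall>\<epsilon>>0. \<exists>\<eta>>0. \<forall>h. \<bar>h\<bar> < \<eta> \<longrightarrow> (\<forall>t. \<bar>(F ^^ t) h\<bar> < \<epsilon>))"

definition attracting_at_zero :: "(real \<Rightarrow> real) \<Rightarrow> bool" where
  "attracting_at_zero F \<longleftrightarrow> (\<exists>\<gamma>>0. \<forall>h. \<bar>h\<bar> < \<gamma> \<longrightarrow> (\<lambda>t. (F ^^ t) h) \<longlonglongrightarrow> 0)"

lemma isCont_eventually_less:
  fixes f :: "real \<Rightarrow> real"
  assumes "isCont f 0" "f 0 < c"
  shows "\<exists>d>0. \<forall>h. \<bar>h\<bar> < d \<longrightarrow> f h < c"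
proof -
  have "eventually (\<lambda>h. f h < c) (nhds 0)"
    using assms order_tendstoD(2)[of f "f 0" "at 0" c]
    by (auto simp: isCont_def eventually_nhds_conv_at)
  then show ?thesis by (auto simp: eventually_nhds_metric dist_real_def)
qed

lemma contracting_stable:
  fixes F P :: "real \<Rightarrow> real"
  assumes F: "\<And>h. F h = h * P h" and cont: "isCont P 0" and P0: "\<bar>P 0\<bar> < 1"
  shows "stable_at_zero F \<and> attracting_at_zero F"
proof -
  obtain \<mu> where \<mu>: "\<bar>P 0\<bar> < \<mu>" "\<mu> < 1" using P0 dense by blast
  have c: "isCont (\<lambda>h. \<bar>P h\<bar>) 0" using cont by (intro continuous_intros)
  obtain d where d: "d > 0" "\<And>h. \<bar>h\<bar> < d \<Longrightarrow> \<bar>P h\<bar> < \<mu>"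
    using isCont_eventually_less[OF c \<mu>(1)] by blast
  have \<mu>0: "0 \<le> \<mu>" using \<mu>(1) by linarith
  have it: "\<bar>(F ^^ t) h\<bar> \<le> \<mu> ^ t * \<bar>h\<bar>" if h: "\<bar>h\<bar> < d" for h t
  proof (induction t)
    case (Suc t)
    have "\<mu> ^ t * \<bar>h\<bar> \<le> 1 * \<bar>h\<bar>"
      by (intro mult_right_mono power_le_one) (use \<mu> \<mu>0 in auto)
    then have "\<bar>(F ^^ t) h\<bar> < d" using Suc h by linarith
    then have "\<bar>P ((F ^^ t) h)\<bar> \<le> \<mu>" using d(2) less_imp_le by blast
    then have "\<bar>(F ^^ t) h\<bar> * \<bar>P ((F ^^ t) h)\<bar> \<le> (\<mu> ^ t * \<bar>h\<bar>) * \<mu>"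
      using Suc by (intro mult_mono) (use \<mu>0 in auto)
    then show ?case by (simp add: F[of "(F ^^ t) h"] abs_mult mult_ac)
  qed simp
  have "stable_at_zero F" unfolding stable_at_zero_def
  proof (intro allI impI)
    fix \<epsilon> :: real assume \<epsilon>: "\<epsilon> > 0"
    have "\<bar>(F ^^ t) h\<bar> < \<epsilon>" if h: "\<bar>h\<bar> < min d \<epsilon>" for h t
    proof -
      have "\<mu> ^ t * \<bar>h\<bar> \<le> 1 * \<bar>h\<bar>"
        by (intro mult_right_mono power_le_one) (use \<mu> \<mu>0 in auto)
      then show ?thesis using it[of h t] h by linarith
    qed
    then show "\<exists>\<eta>>0. \<forall>h. \<bar>h\<bar> < \<eta> \<longrightarrow> (\<forall>t. \<bar>(F ^^ t) h\<bar> < \<epsilon>)"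
      using \<epsilon> d(1) by (intro exI[of _ "min d \<epsilon>"]) auto
  qed
  moreover have "(\<lambda>t. (F ^^ t) h) \<longlonglongrightarrow> 0" if h: "\<bar>h\<bar> < d" for h
  proof (rule tendsto_0_le[where K = 1])
    show "eventually (\<lambda>t. norm ((F ^^ t) h) \<le> norm (\<mu> ^ t * \<bar>h\<bar>) * 1) sequentially"
      using it[OF h] \<mu>0 by simp
    show "(\<lambda>t. \<mu> ^ t * \<bar>h\<bar>) \<longlonglongrightarrow> 0"
      by (intro tendsto_mult_left_zero LIMSEQ_power_zero) (use \<mu> \<mu>0 in auto)
  qed
  ultimately show ?thesis using d(1) unfolding attracting_at_zero_def by blast
qed

lemma expanding_not_stable:
  fixes F P :: "real \<Rightarrow> real"
  assumes F: "\<And>h. F h = h * P h" and cont: "isCont P 0" and P0: "\<bar>P 0\<bar> > 1"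
  shows "\<not> stable_at_zero F"
proof
  assume stab: "stable_at_zero F"
  obtain \<mu> where \<mu>: "1 < \<mu>" "\<mu> < \<bar>P 0\<bar>" using P0 dense by blast
  have c: "isCont (\<lambda>h. - \<bar>P h\<bar>) 0" using cont by (intro continuous_intros)
  obtain d where d: "d > 0" "\<And>h. \<bar>h\<bar> < d \<Longrightarrow> - \<bar>P h\<bar> < - \<mu>"
    using isCont_eventually_less[OF c, of "- \<mu>"] \<mu>(2) by auto
  obtain \<eta> where \<eta>: "\<eta> > 0" "\<And>h t. \<bar>h\<bar> < \<eta> \<Longrightarrow> \<bar>(F ^^ t) h\<bar> < d"
    using stab d(1) unfolding stable_at_zero_def by meson
  define h where "h = \<eta> / 2"
  have h: "h > 0" "\<bar>h\<bar> < \<eta>" using \<eta>(1) by (auto simp: h_def)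
  have it: "\<mu> ^ t * h \<le> \<bar>(F ^^ t) h\<bar>" for t
  proof (induction t)
    case 0 then show ?case using h by simp
  next
    case (Suc t)
    have "(\<mu> ^ t * h) * \<mu> \<le> \<bar>(F ^^ t) h\<bar> * \<bar>P ((F ^^ t) h)\<bar>"
      using Suc d(2)[OF \<eta>(2)[OF h(2), of t]] by (intro mult_mono) (use \<mu> in auto)
    then show ?case by (simp add: F[of "(F ^^ t) h"] abs_mult mult_ac)
  qed
  obtain n where "d / h < \<mu> ^ n" using real_arch_pow[OF \<mu>(1)] by blast
  then have "d < \<mu> ^ n * h" using h(1) by (simp add: field_simps)
  with it[of n] \<eta>(2)[OF h(2), of n] show False by linarith
qed

lemma flip_stable:
  fixes F P K :: "real \<Rightarrow> real"
  assumes F: "\<And>h. F h = h * P h" and cont: "isCont P 0" and P0: "P 0 = -1"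
    and K: "\<And>h. P h * P (F h) = 1 - h\<^sup>2 * K h" and contK: "isCont K 0" and K0: "K 0 > 0"
  shows "stable_at_zero F \<and> attracting_at_zero F"
proof -
  define \<kappa> where "\<kappa> = K 0 / 2"
  have \<kappa>: "\<kappa> > 0" using K0 by (simp add: \<kappa>_def)
  have c1: "isCont (\<lambda>h. \<bar>P h\<bar>) 0" using cont by (intro continuous_intros)
  have c2: "isCont (\<lambda>h. - K h) 0" using contK by (intro continuous_intros)
  have c3: "isCont (\<lambda>h. h\<^sup>2 * K h) 0" using contK by (intro continuous_intros)
  obtain d1 where d1: "d1 > 0" "\<And>h. \<bar>h\<bar> < d1 \<Longrightarrow> \<bar>P h\<bar> < 2"
    using isCont_eventually_less[OF c1, of 2] P0 by auto
  obtain d2 where d2: "d2 > 0" "\<And>h. \<bar>h\<bar> < d2 \<Longrightarrow> - K h < - \<kappa>"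
    using isCont_eventually_less[OF c2, of "- \<kappa>"] K0 by (auto simp: \<kappa>_def)
  obtain d3 where d3: "d3 > 0" "\<And>h. \<bar>h\<bar> < d3 \<Longrightarrow> h\<^sup>2 * K h < 1"
    using isCont_eventually_less[OF c3, of 1] by auto
  define d where "d = min d1 (min d2 d3)"
  have d: "d > 0" using d1 d2 d3 by (auto simp: d_def)
  have FF: "\<bar>F (F h)\<bar> \<le> \<bar>h\<bar> * (1 - \<kappa> * \<bar>h\<bar>\<^sup>2)" if h: "\<bar>h\<bar> < d" for h
  proof -
    have "F (F h) = h * (P h * P (F h))" using F[of "F h"] F[of h] by (simp add: mult.assoc)
    then have eq: "F (F h) = h * (1 - h\<^sup>2 * K h)" by (simp only: K)
    have "h\<^sup>2 * \<kappa> \<le> h\<^sup>2 * K h" using d2(2)[of h] h by (intro mult_left_mono) (auto simp: d_def)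
    moreover have "h\<^sup>2 * K h < 1" using d3(2)[of h] h by (auto simp: d_def)
    ultimately have "\<bar>1 - h\<^sup>2 * K h\<bar> \<le> 1 - \<kappa> * \<bar>h\<bar>\<^sup>2" by (simp add: mult.commute)
    then show ?thesis unfolding eq abs_mult by (intro mult_left_mono) auto
  qed
  have FF': "\<bar>F (F h)\<bar> \<le> \<bar>h\<bar>" if h: "\<bar>h\<bar> < d" for h
  proof -
    have "\<bar>h\<bar> * (1 - \<kappa> * \<bar>h\<bar>\<^sup>2) \<le> \<bar>h\<bar> * 1" using \<kappa> by (intro mult_left_mono) auto
    then show ?thesis using FF[OF h] by linarith
  qed
  define e where "e h n = (F ^^ (2 * n)) h" for h n
  have e_Suc: "e h (Suc n) = F (F (e h n))" for h n by (simp add: e_def)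
  have e_le: "\<bar>e h n\<bar> \<le> \<bar>h\<bar>" if h: "\<bar>h\<bar> < d" for h n
  proof (induction n)
    case 0 then show ?case by (simp add: e_def)
  next
    case (Suc n) then show ?case using FF'[of "e h n"] h unfolding e_Suc by linarith
  qed
  have it: "\<bar>(F ^^ t) h\<bar> \<le> 2 * \<bar>e h (t div 2)\<bar>" if h: "\<bar>h\<bar> < d" for h t
  proof (cases "even t")
    case True then show ?thesis by (simp add: e_def)
  next
    case False
    then have "t = Suc (2 * (t div 2))" by simp
    then have "(F ^^ t) h = F (e h (t div 2))" unfolding e_def by (metis funpow.simps(2) comp_apply)
    moreover have "\<bar>P (e h (t div 2))\<bar> \<le> 2"
      using d1(2)[of "e h (t div 2)"] e_le[OF h, of "t div 2"] h by (auto simp: d_def)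
    ultimately show ?thesis
      using mult_left_mono[of "\<bar>P (e h (t div 2))\<bar>" 2 "\<bar>e h (t div 2)\<bar>"] by (simp add: F abs_mult mult.commute)
  qed
  have lim: "(\<lambda>n. \<bar>e h n\<bar>) \<longlonglongrightarrow> 0" if h: "\<bar>h\<bar> < d" for h
  proof -
    have small: "\<bar>e h n\<bar> < d" for n using e_le[OF h, of n] h by linarith
    have dec: "decseq (\<lambda>n. \<bar>e h n\<bar>)"
      by (rule decseq_SucI) (use FF'[OF small] in \<open>simp add: e_Suc\<close>)
    obtain L where L: "(\<lambda>n. \<bar>e h n\<bar>) \<longlonglongrightarrow> L" "\<And>n. L \<le> \<bar>e h n\<bar>"
      using decseq_convergent[OF dec, of 0] by auto
    have L0: "0 \<le> L" by (rule LIMSEQ_le_const[OF L(1)]) auto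
    have "L \<le> L * (1 - \<kappa> * L\<^sup>2)"
    proof (rule LIMSEQ_le)
      show "(\<lambda>n. \<bar>e h (Suc n)\<bar>) \<longlonglongrightarrow> L" using L(1) by (rule LIMSEQ_Suc)
      show "(\<lambda>n. \<bar>e h n\<bar> * (1 - \<kappa> * \<bar>e h n\<bar>\<^sup>2)) \<longlonglongrightarrow> L * (1 - \<kappa> * L\<^sup>2)"
        using L(1) by (intro tendsto_intros)
      show "\<exists>N. \<forall>n\<ge>N. \<bar>e h (Suc n)\<bar> \<le> \<bar>e h n\<bar> * (1 - \<kappa> * \<bar>e h n\<bar>\<^sup>2)"
        using FF[OF small] by (simp add: e_Suc)
    qed
    then have "\<kappa> * (L * L\<^sup>2) \<le> 0" by (simp add: algebra_simps)
    then have "L * L\<^sup>2 \<le> 0" using \<kappa> by (simp add: mult_le_0_iff)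
    then have "L = 0" using L0 by (auto simp: mult_le_0_iff)
    then show ?thesis using L by simp
  qed
  have "stable_at_zero F" unfolding stable_at_zero_def
  proof (intro allI impI)
    fix \<epsilon> :: real assume \<epsilon>: "\<epsilon> > 0"
    have "\<bar>(F ^^ t) h\<bar> < \<epsilon>" if "\<bar>h\<bar> < min d (\<epsilon> / 2)" for h t
      using it[of h t] e_le[of h "t div 2"] that by auto
    then show "\<exists>\<eta>>0. \<forall>h. \<bar>h\<bar> < \<eta> \<longrightarrow> (\<forall>t. \<bar>(F ^^ t) h\<bar> < \<epsilon>)"
      using \<epsilon> d by (intro exI[of _ "min d (\<epsilon> / 2)"]) auto
  qed
  moreover have "(\<lambda>t. (F ^^ t) h) \<longlonglongrightarrow> 0" if h: "\<bar>h\<bar> < d" for h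
  proof (rule tendsto_0_le[where K = 1])
    show "eventually (\<lambda>t. norm ((F ^^ t) h) \<le> norm (2 * \<bar>e h (t div 2)\<bar>) * 1) sequentially"
      using it[OF h] by simp
    have "filterlim (\<lambda>t::nat. t div 2) sequentially sequentially"
      unfolding filterlim_at_top
    proof
      fix Z :: nat
      show "eventually (\<lambda>t. Z \<le> t div 2) sequentially"
        using eventually_ge_at_top[of "2 * Z"] by eventually_elim simp
    qed
    from filterlim_compose[OF lim[OF h] this]
    show "(\<lambda>t. 2 * \<bar>e h (t div 2)\<bar>) \<longlonglongrightarrow> 0" by (intro tendsto_mult_right_zero)
  qed
  ultimately show ?thesis using d unfolding attracting_at_zero_def by blast
qed

text \<open>With \<open>p\<close>, \<open>v\<close>, \<open>s\<close> the derivatives of \<open>g\<close> at the successive points of a 3-cycle starting at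
  \<open>x\<close>, the map \<open>return_dev p v s\<close> is \<open>g\<close> iterated three times, in the coordinate \<open>h = a (x\<^sub>0 - x)\<close>.\<close>

definition return_factor :: "real \<Rightarrow> real \<Rightarrow> real \<Rightarrow> real \<Rightarrow> real" where
  "return_factor p v s h = (let m = (p + h) * (v + p * h + h\<^sup>2) in m * (s + h * m))"

definition return_dev :: "real \<Rightarrow> real \<Rightarrow> real \<Rightarrow> real \<Rightarrow> real" where
  "return_dev p v s h = h * return_factor p v s h"

lemma isCont_return_factor: "isCont (return_factor p v s) 0"
proof -
  have "isCont (\<lambda>h. ((p + h) * (v + p * h + h\<^sup>2)) * (s + h * ((p + h) * (v + p * h + h\<^sup>2)))) 0"
    by (intro continuous_intros)
  then show ?thesis by (simp add: return_factor_def[abs_def] Let_def)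
qed

lemma return_dev_flip:
  assumes pqs: "p * v * s = -1"
  shows "stable_at_zero (return_dev p v s) \<and> attracting_at_zero (return_dev p v s)"
proof -
  define m where "m h = (p + h) * (v + p * h + h\<^sup>2)" for h
  define n where "n h = p\<^sup>2 + v + 2 * p * h + h\<^sup>2" for h
  define U where "U h = s * n h + (m h)\<^sup>2" for h
  define V where "V h = s * (2 * p + h) + 2 * p * v * n h + h * (n h)\<^sup>2" for h
  define P where "P = return_factor p v s"
  define F where "F = return_dev p v s"
  have F: "F h = h * P h" for h by (simp add: F_def P_def return_dev_def)
  have mn: "m h = p * v + h * n h" for h
    by (simp add: m_def n_def algebra_simps power2_eq_square)
  have nn: "n h = p\<^sup>2 + v + h * (2 * p + h)" for h
    by (simp add: n_def algebra_simps power2_eq_square)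
  have Pm: "P h = m h * (s + h * m h)" for h by (simp add: P_def return_factor_def m_def Let_def)
  have PU: "P h = -1 + h * U h" for h
  proof -
    have "P h = s * m h + h * (m h)\<^sup>2" by (simp add: Pm algebra_simps power2_eq_square)
    also have "\<dots> = p * v * s + h * U h" unfolding U_def
      by (subst (1) mn) (simp add: algebra_simps)
    finally show ?thesis by (simp add: pqs)
  qed
  have UV: "U h = U 0 + h * V h" for h
  proof -
    have "U h - U 0 = s * (n h - n 0) + ((m h)\<^sup>2 - (m 0)\<^sup>2)" by (simp add: U_def algebra_simps)
    also have "\<dots> = s * (h * (2 * p + h)) + ((p * v + h * n h)\<^sup>2 - (p * v)\<^sup>2)"
      unfolding mn by (subst (1) nn) (simp add: n_def)
    also have "\<dots> = h * V h" by (simp add: V_def algebra_simps power2_eq_square)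
    finally show ?thesis by simp
  qed
  define K where "K h = V h - P h * V (F h) + U h * (2 - h * U h) * U (F h)" for h
  have K: "P h * P (F h) = 1 - h\<^sup>2 * K h" for h
  proof -
    have "U (F h) = U 0 + h * P h * V (F h)" using UV[of "F h"] F by simp
    then have "U h - U (F h) = h * (V h - P h * V (F h))" using UV[of h] by (simp add: algebra_simps)
    then have hK: "h * K h = U h - U (F h) + (1 - (P h)\<^sup>2) * U (F h)"
      unfolding K_def PU[of h] by (simp add: algebra_simps power2_eq_square)
    have "P h * P (F h) = P h * (-1 + h * P h * U (F h))" using PU[of "F h"] F by simp
    also have "\<dots> = 1 - h * (U h - U (F h) + (1 - (P h)\<^sup>2) * U (F h))"
      unfolding PU[of h] by (simp add: algebra_simps power2_eq_square)
    finally show ?thesis unfolding hK[symmetric] by (simp add: power2_eq_square)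
  qed
  have nz: "p \<noteq> 0" "v \<noteq> 0" using pqs by auto
  have "K 0 = 2 * (s * (2 * p) + 2 * p * v * (p\<^sup>2 + v)) + 2 * (s * (p\<^sup>2 + v) + (p * v)\<^sup>2)\<^sup>2"
    by (simp add: K_def PU[of 0] F V_def U_def n_def m_def power2_eq_square)
  \<comment> \<open>a sum of squares for every \<open>p v s = -1\<close>: up to a positive factor, minus the Schwarzian derivative\<close>
  also have "\<dots> = 2 * ((s * p\<^sup>2)\<^sup>2 + (s * v)\<^sup>2 + (p * v) ^ 4)"
    using pqs by algebra
  also have "\<dots> > 0" using nz by (intro mult_pos_pos add_nonneg_pos add_nonneg_nonneg) auto
  finally have K0: "K 0 > 0" .
  have P0: "P 0 = -1" by (simp add: PU)
  have contU: "continuous_on UNIV U" unfolding U_def[abs_def] n_def m_def by (intro continuous_intros)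
  have contV: "continuous_on UNIV V" unfolding V_def[abs_def] n_def by (intro continuous_intros)
  have contP: "continuous_on UNIV P"
    unfolding PU[abs_def] by (intro continuous_intros contU)
  have contF: "continuous_on UNIV F"
    unfolding F[abs_def] by (intro continuous_intros contP)
  have "continuous_on UNIV K" unfolding K_def[abs_def]
    by (intro continuous_intros contU contV contP
        continuous_on_compose2[OF contU contF] continuous_on_compose2[OF contV contF]) auto
  then have contK: "isCont K 0" by (simp add: continuous_on_eq_continuous_at)
  have "isCont P 0" using contP by (simp add: continuous_on_eq_continuous_at)
  from flip_stable[OF F this P0 K contK K0] show ?thesis by (simp add: F_def)
qed

lemma return_dev_stability:
  assumes "p * v * s < 1"
  shows "stable_at_zero (return_dev p v s) \<and> attracting_at_zero (return_dev p v s)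
     \<longleftrightarrow> -1 \<le> p * v * s"
proof -
  have F: "return_dev p v s h = h * return_factor p v s h" for h by (simp add: return_dev_def)
  have P0: "return_factor p v s 0 = p * v * s" by (simp add: return_factor_def)
  consider "p * v * s < -1" | "p * v * s = -1" | "-1 < p * v * s" by linarith
  then show ?thesis
  proof cases
    case 1
    then show ?thesis using expanding_not_stable[OF F isCont_return_factor] by (simp add: P0)
  next
    case 2
    then show ?thesis using return_dev_flip by simp
  next
    case 3
    then show ?thesis using contracting_stable[OF F isCont_return_factor] assms by (simp add: P0)
  qed
qed

lemma quad_dev: "a * (quad a b c u - quad a b c x) = a * (u - x) * (2 * a * x + b + a * (u - x))"
  by (simp add: quad_def algebra_simps power2_eq_square)

lemma quad_iterate_dev:
  assumes "is_rep3 (quad a b c) (x, y, z)"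
  defines "p \<equiv> 2 * a * x + b" and "v \<equiv> 2 * a * y + b" and "s \<equiv> 2 * a * z + b"
  shows "a * ((quad a b c ^^ (3 * t)) u - x) = (return_dev p v s ^^ t) (a * (u - x))"
proof (induction t)
  case (Suc t)
  let ?g = "quad a b c"
  define u' where "u' = (?g ^^ (3 * t)) u"
  define h where "h = a * (u' - x)"
  have g: "?g x = y" "?g y = z" "?g z = x" using assms(1) by (auto simp: is_rep3_def)
  have 1: "a * (?g u' - y) = h * (p + h)" using quad_dev[of a b c u' x] by (simp add: g p_def h_def)
  have 2: "a * (?g (?g u') - z) = h * (p + h) * (v + h * (p + h))"
    using quad_dev[of a b c "?g u'" y] by (simp add: g v_def 1)
  have 3: "a * (?g (?g (?g u')) - x) = h * (p + h) * (v + h * (p + h)) *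
      (s + h * (p + h) * (v + h * (p + h)))"
    using quad_dev[of a b c "?g (?g u')" z] by (simp add: g s_def 2)
  have "(?g ^^ (3 * Suc t)) u = ?g (?g (?g u'))" by (simp add: u'_def eval_nat_numeral)
  then have "a * ((?g ^^ (3 * Suc t)) u - x) = return_dev p v s h" using 3
    by (simp add: return_dev_def return_factor_def Let_def algebra_simps power2_eq_square)
  then show ?case using Suc by (simp add: h_def u'_def)
qed simp

lemma stability_conjugate:
  assumes a: "a \<noteq> 0" and rep: "is_rep3 (quad a b c) (x, y, z)"
  defines "F \<equiv> return_dev (2 * a * x + b) (2 * a * y + b) (2 * a * z + b)"
  shows "lyapunov_stable3 (quad a b c) x \<and>
      (\<exists>\<gamma>>0. \<forall>x0. \<bar>x0 - x\<bar> < \<gamma> \<longrightarrow> (\<lambda>t. (quad a b c ^^ (3 * t)) x0) \<longlonglongrightarrow> x)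
    \<longleftrightarrow> stable_at_zero F \<and> attracting_at_zero F"
proof -
  let ?g = "quad a b c"
  have it: "a * ((?g ^^ (3 * t)) u - x) = (F ^^ t) (a * (u - x))" for t u
    unfolding F_def by (rule quad_iterate_dev[OF rep])
  have fixpt: "(?g ^^ 3) x = x" using rep by (simp add: is_rep3_def eval_nat_numeral)
  have dev: "(?g ^^ (3 * t)) u = x + (F ^^ t) (a * (u - x)) / a" for t u
    using a by (simp add: it[symmetric])
  have dev': "(F ^^ t) h = a * ((?g ^^ (3 * t)) (x + h / a) - x)" for t h
    using a by (simp add: it)
  have scale: "\<bar>a * w\<bar> < e \<longleftrightarrow> \<bar>w\<bar> < e / \<bar>a\<bar>" for w e
    using a by (simp add: abs_mult field_simps)
  have scale': "\<bar>x + h / a - x\<bar> < e \<longleftrightarrow> \<bar>h\<bar> < \<bar>a\<bar> * e" for h e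
    using a by (simp add: field_simps)
  have pos: "0 < \<bar>a\<bar> * \<epsilon>" "0 < \<epsilon> / \<bar>a\<bar>" if "0 < \<epsilon>" for \<epsilon> :: real
    using a that by simp_all
  have "lyapunov_stable3 ?g x \<longleftrightarrow> stable_at_zero F"
  proof
    assume l: "lyapunov_stable3 ?g x"
    show "stable_at_zero F" unfolding stable_at_zero_def
    proof (intro allI impI)
      fix \<epsilon> :: real assume "\<epsilon> > 0"
      then obtain \<eta> where \<eta>: "\<eta> > 0"
        "\<And>x0 t. \<bar>x0 - x\<bar> < \<eta> \<Longrightarrow> \<bar>(?g ^^ (3 * t)) x0 - x\<bar> < \<epsilon> / \<bar>a\<bar>"
        using l pos(2) unfolding lyapunov_stable3_def by meson
      have "\<bar>(F ^^ t) h\<bar> < \<epsilon>" if "\<bar>h\<bar> < \<bar>a\<bar> * \<eta>" for h t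
        using \<eta>(2) that unfolding dev' scale scale'[symmetric] .
      then show "\<exists>\<eta>>0. \<forall>h. \<bar>h\<bar> < \<eta> \<longrightarrow> (\<forall>t. \<bar>(F ^^ t) h\<bar> < \<epsilon>)"
        using pos(1)[OF \<eta>(1)] by blast
    qed
  next
    assume l: "stable_at_zero F"
    show "lyapunov_stable3 ?g x" unfolding lyapunov_stable3_def
    proof (intro conjI fixpt allI impI)
      fix \<epsilon> :: real assume "\<epsilon> > 0"
      then obtain \<eta> where \<eta>: "\<eta> > 0" "\<And>h t. \<bar>h\<bar> < \<eta> \<Longrightarrow> \<bar>(F ^^ t) h\<bar> < \<bar>a\<bar> * \<epsilon>"
        using l pos(1) unfolding stable_at_zero_def by meson
      have "\<bar>(?g ^^ (3 * t)) u - x\<bar> < \<epsilon>" if "\<bar>u - x\<bar> < \<eta> / \<bar>a\<bar>" for u t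
        using \<eta>(2) that unfolding dev scale' scale[symmetric] .
      then show "\<exists>\<eta>>0. \<forall>x0. \<bar>x0 - x\<bar> < \<eta> \<longrightarrow> (\<forall>t. \<bar>(?g ^^ (3 * t)) x0 - x\<bar> < \<epsilon>)"
        using pos(2)[OF \<eta>(1)] by blast
    qed
  qed
  moreover have "(\<exists>\<gamma>>0. \<forall>x0. \<bar>x0 - x\<bar> < \<gamma> \<longrightarrow> (\<lambda>t. (?g ^^ (3 * t)) x0) \<longlonglongrightarrow> x)
      \<longleftrightarrow> attracting_at_zero F"
    unfolding attracting_at_zero_def
  proof
    assume "\<exists>\<gamma>>0. \<forall>x0. \<bar>x0 - x\<bar> < \<gamma> \<longrightarrow> (\<lambda>t. (?g ^^ (3 * t)) x0) \<longlonglongrightarrow> x"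
    then obtain \<gamma> where \<gamma>: "\<gamma> > 0" "\<And>x0. \<bar>x0 - x\<bar> < \<gamma> \<Longrightarrow> (\<lambda>t. (?g ^^ (3 * t)) x0) \<longlonglongrightarrow> x" by blast
    have "(\<lambda>t. (F ^^ t) h) \<longlonglongrightarrow> 0" if "\<bar>h\<bar> < \<bar>a\<bar> * \<gamma>" for h
      unfolding dev' using \<gamma>(2)[of "x + h / a"] that unfolding scale'
      by (intro tendsto_mult_right_zero LIM_zero)
    then show "\<exists>\<gamma>>0. \<forall>h. \<bar>h\<bar> < \<gamma> \<longrightarrow> (\<lambda>t. (F ^^ t) h) \<longlonglongrightarrow> 0"
      using pos(1)[OF \<gamma>(1)] by blast
  next
    assume "\<exists>\<gamma>>0. \<forall>h. \<bar>h\<bar> < \<gamma> \<longrightarrow> (\<lambda>t. (F ^^ t) h) \<longlonglongrightarrow> 0"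
    then obtain \<gamma> where \<gamma>: "\<gamma> > 0" "\<And>h. \<bar>h\<bar> < \<gamma> \<Longrightarrow> (\<lambda>t. (F ^^ t) h) \<longlonglongrightarrow> 0" by blast
    have "(\<lambda>t. (?g ^^ (3 * t)) u) \<longlonglongrightarrow> x" if "\<bar>u - x\<bar> < \<gamma> / \<bar>a\<bar>" for u
    proof -
      have "(\<lambda>t. x + (F ^^ t) (a * (u - x)) / a) \<longlonglongrightarrow> x + 0 / a"
        using \<gamma>(2)[of "a * (u - x)"] that a unfolding scale by (intro tendsto_intros) auto
      then show ?thesis unfolding dev by simp
    qed
    then show "\<exists>\<gamma>>0. \<forall>x0. \<bar>x0 - x\<bar> < \<gamma> \<longrightarrow> (\<lambda>t. (?g ^^ (3 * t)) x0) \<longlonglongrightarrow> x"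
      using pos(2)[OF \<gamma>(1)] by blast
  qed
  ultimately show ?thesis by blast
qed

text \<open>The value of \<open>\<beta>\<close> for which \<open>r\<close> is a root of \<open>Q \<beta>\<close> (for \<open>r \<noteq> 0, -1\<close>).\<close>

definition ratio_param :: "real \<Rightarrow> real" where
  "ratio_param r = r - 1 / r - 1 / (r + 1)"

lemma Q_root_iff: "poly (Q \<beta>) r = 0 \<longleftrightarrow> r \<noteq> 0 \<and> r \<noteq> -1 \<and> ratio_param r = \<beta>"
proof -
  have e: "poly (Q \<beta>) r = r ^ 3 + (1 - \<beta>) * r\<^sup>2 - (2 + \<beta>) * r - 1"
    by (simp add: Q_def algebra_simps eval_nat_numeral)
  show ?thesis
  proof (cases "r = 0 \<or> r = -1")
    case True then show ?thesis by (auto simp: Q_def)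
  next
    case False
    then have nz: "r \<noteq> 0" "r + 1 \<noteq> 0" by auto
    have "r * (1 / r) = 1" "(r + 1) * (1 / (r + 1)) = 1" using nz by simp_all
    then have "r * (r + 1) * (ratio_param r - \<beta>) = poly (Q \<beta>) r"
      unfolding e ratio_param_def by algebra
    then show ?thesis using False nz by auto
  qed
qed

lemma ratio_param_less_iff:
  assumes "r * l > 0" "(r + 1) * (l + 1) > 0"
  shows "ratio_param l < ratio_param r \<longleftrightarrow> l < r"
proof -
  have nz: "r \<noteq> 0" "l \<noteq> 0" "r + 1 \<noteq> 0" "l + 1 \<noteq> 0" using assms by auto
  have eq: "ratio_param r - ratio_param l = (r - l) * (1 + 1 / (r * l) + 1 / ((r + 1) * (l + 1)))"
  proof -
    have "1 / l - 1 / r = (r - l) * (1 / (r * l))" using nz by (simp add: field_simps)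
    moreover have "1 / (l + 1) - 1 / (r + 1) = (r - l) * (1 / ((r + 1) * (l + 1)))"
      using nz by (simp add: diff_frac_eq mult.commute)
    ultimately show ?thesis unfolding ratio_param_def by (simp only: distrib_left) simp
  qed
  have "1 / (r * l) > 0" "1 / ((r + 1) * (l + 1)) > 0" using assms by auto
  then have "1 + 1 / (r * l) + 1 / ((r + 1) * (l + 1)) > 0" by linarith
  then have "0 < ratio_param r - ratio_param l \<longleftrightarrow> 0 < r - l"
    unfolding eq by (simp add: zero_less_mult_iff)
  then show ?thesis by simp
qed

lemma next_root:
  assumes "poly (Q \<beta>) r = 0"
  shows "poly (Q \<beta>) (- (r + 1) / r) = 0" "poly (Q \<beta>) (- 1 / (r + 1)) = 0"
proof -
  have r: "r \<noteq> 0" "r + 1 \<noteq> 0" "ratio_param r = \<beta>" using assms by (auto simp: Q_root_iff)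
  have e: "1 / (- (r + 1) / r) = 1 / (r + 1) - 1" "1 / (- (r + 1) / r + 1) = - r"
    "- (r + 1) / r = - 1 - 1 / r"
    using r(1,2) by (simp_all add: divide_simps, (simp_all add: algebra_simps)?)
  have "ratio_param (- (r + 1) / r) = \<beta>"
    using r(3) unfolding ratio_param_def unfolding e(1,2) unfolding e(3) by simp
  moreover have "- (r + 1) / r \<noteq> 0" "- (r + 1) / r \<noteq> -1" using r(1,2) by (simp_all add: field_simps)
  ultimately show "poly (Q \<beta>) (- (r + 1) / r) = 0" unfolding Q_root_iff by blast
  have e': "1 / (- 1 / (r + 1)) = - (r + 1)" "1 / (- 1 / (r + 1) + 1) = 1 + 1 / r"
    using r(1,2) by (simp_all add: divide_simps, (simp_all add: algebra_simps)?)
  have "ratio_param (- 1 / (r + 1)) = \<beta>"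
    using r(3) unfolding ratio_param_def unfolding e' by simp
  moreover have "- 1 / (r + 1) \<noteq> 0" "- 1 / (r + 1) \<noteq> -1" using r(1,2) by (simp_all add: field_simps)
  ultimately show "poly (Q \<beta>) (- 1 / (r + 1)) = 0" unfolding Q_root_iff by blast
qed

lemma Q_roots:
  assumes "poly (Q \<beta>) r = 0"
  shows "{t. poly (Q \<beta>) t = 0} = {r, - (r + 1) / r, - 1 / (r + 1)}"
proof -
  have r: "r \<noteq> 0" "r + 1 \<noteq> 0" and \<beta>: "\<beta> = ratio_param r" using assms by (auto simp: Q_root_iff)
  define i w where iw: "i = 1 / r" "w = 1 / (r + 1)"
  have i: "r * i = 1" "(r + 1) * w = 1" using r by (simp_all add: iw)
  have e: "- (r + 1) / r = - 1 - i" "- 1 / (r + 1) = - w" using r unfolding iw by (simp_all add: divide_simps, (simp_all add: algebra_simps)?)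
  have \<beta>iw: "\<beta> = r - i - w" by (simp add: \<beta> ratio_param_def iw)
  have "poly (Q \<beta>) t = t ^ 3 + (1 - \<beta>) * t\<^sup>2 - (2 + \<beta>) * t - 1" for t
    by (simp add: Q_def algebra_simps eval_nat_numeral)
  moreover have "t ^ 3 + (1 - \<beta>) * t\<^sup>2 - (2 + \<beta>) * t - 1 = (t - r) * (t - (- 1 - i)) * (t - (- w))" for t
    using i \<beta>iw by algebra
  ultimately have "poly (Q \<beta>) t = (t - r) * (t - (- (r + 1) / r)) * (t - (- 1 / (r + 1)))" for t
    unfolding e by simp
  then show ?thesis by auto
qed

lemma roots_distinct:
  fixes r :: real
  assumes "r \<noteq> 0" "r + 1 \<noteq> 0"
  shows "r \<noteq> - (r + 1) / r" "- (r + 1) / r \<noteq> - 1 / (r + 1)" "- 1 / (r + 1) \<noteq> r"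
proof -
  have "r\<^sup>2 + r + 1 = (r + 1 / 2)\<^sup>2 + 3 / 4" by (simp add: power2_eq_square algebra_simps)
  then have pos: "r\<^sup>2 + r + 1 > 0" using zero_le_power2[of "r + 1 / 2"] by linarith
  then show "r \<noteq> - (r + 1) / r" "- (r + 1) / r \<noteq> - 1 / (r + 1)" "- 1 / (r + 1) \<noteq> r"
    using assms by (auto simp: field_simps power2_eq_square)
qed

lemma Q_root_exists:
  assumes "\<beta> > 0"
  shows "\<exists>r. poly (Q \<beta>) r = 0"
proof -
  have "poly (Q \<beta>) (\<beta> + 2) = 2 * (\<beta> + 2)\<^sup>2 - 1" by (simp add: Q_def algebra_simps power2_eq_square)
  moreover have "(\<beta> + 2)\<^sup>2 \<ge> 2\<^sup>2" using assms by (intro power_mono) auto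
  ultimately have "poly (Q \<beta>) (\<beta> + 2) > 0" by simp
  moreover have "poly (Q \<beta>) 0 < 0" by (simp add: Q_def)
  ultimately show ?thesis using poly_IVT_pos[of 0 "\<beta> + 2" "Q \<beta>"] assms by auto
qed

definition root_point :: "real \<Rightarrow> real \<Rightarrow> real \<Rightarrow> real \<Rightarrow> real" where
  "root_point a b \<beta> r = (- b + \<beta> + 1) / (2 * a) + 1 / (a * r)"

definition root_triple :: "real \<Rightarrow> real \<Rightarrow> real \<Rightarrow> real \<Rightarrow> real \<times> real \<times> real" where
  "root_triple a b \<beta> r =
     (root_point a b \<beta> r, root_point a b \<beta> (- (r + 1) / r), root_point a b \<beta> (- 1 / (r + 1)))"

lemma deriv_at_root_point:
  assumes "a \<noteq> 0"
  shows "2 * a * root_point a b \<beta> r + b = \<beta> + 1 + 2 / r"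
  using assms by (simp add: root_point_def field_simps)

lemma root_point_inj:
  assumes "a \<noteq> 0" "r \<noteq> 0" "t \<noteq> 0" "root_point a b \<beta> r = root_point a b \<beta> t"
  shows "r = t"
  using assms by (simp add: root_point_def)

lemma quad_root_point:
  assumes a: "a \<noteq> 0" and r: "poly (Q \<beta>) r = 0" and \<beta>: "\<beta>\<^sup>2 = delta a b c"
  shows "quad a b c (root_point a b \<beta> r) = root_point a b \<beta> (- (r + 1) / r)"
proof -
  let ?x = "root_point a b \<beta> r" and ?y = "root_point a b \<beta> (- (r + 1) / r)"
  have nz: "r \<noteq> 0" "r + 1 \<noteq> 0" and \<beta>r: "\<beta> = ratio_param r" using r by (auto simp: Q_root_iff)
  define i w where iw: "i = 1 / r" "w = 1 / (r + 1)"
  have i: "r * i = 1" "(r + 1) * w = 1" using nz by (simp_all add: iw)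
  have e: "2 / r = 2 * i" "2 / (- (r + 1) / r) = 2 * w - 2" using nz unfolding iw by (simp_all add: divide_simps, (simp_all add: algebra_simps)?)
  have \<beta>iw: "\<beta> = r - i - w" by (simp add: \<beta>r ratio_param_def iw)
  have "4 * a * quad a b c ?x = (2 * a * ?x + b)\<^sup>2 - b\<^sup>2 + 4 * a * c"
    by (simp add: quad_def algebra_simps power2_eq_square)
  also have "\<dots> = (\<beta> + 1 + 2 * i)\<^sup>2 - 2 * b - 7 - \<beta>\<^sup>2"
    using \<beta> unfolding deriv_at_root_point[OF a] e by (simp add: delta_def)
  also have "\<dots> = 2 * (\<beta> + 1 + (2 * w - 2)) - 2 * b"
    using i \<beta>iw by algebra
  also have "\<dots> = 4 * a * ?y"
    using deriv_at_root_point[OF a, of b \<beta> "- (r + 1) / r"] unfolding e by algebra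
  finally show ?thesis using a by simp
qed

lemma next_root_simps:
  fixes r :: real
  assumes "r \<noteq> 0" "r + 1 \<noteq> 0"
  shows "- (- (r + 1) / r + 1) / (- (r + 1) / r) = - 1 / (r + 1)"
    "- (- 1 / (r + 1) + 1) / (- 1 / (r + 1)) = r"
    "- 1 / (- (r + 1) / r + 1) = r"
    "- 1 / (- 1 / (r + 1) + 1) = - (r + 1) / r"
  using assms by (simp_all add: divide_simps, (simp_all add: algebra_simps)?)

lemma is_rep3_root_triple:
  assumes a: "a \<noteq> 0" and r: "poly (Q \<beta>) r = 0" and \<beta>: "\<beta>\<^sup>2 = delta a b c"
  shows "is_rep3 (quad a b c) (root_triple a b \<beta> r)"
proof -
  have nz: "r \<noteq> 0" "r + 1 \<noteq> 0" using r by (auto simp: Q_root_iff)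
  have nz': "- (r + 1) / r \<noteq> 0" "- 1 / (r + 1) \<noteq> 0"
    using next_root[OF r] by (auto simp: Q_root_iff)
  note s = next_root_simps[OF nz] and d = roots_distinct[OF nz]
  show ?thesis unfolding is_rep3_def root_triple_def prod.case
    using root_point_inj[OF a nz(1) nz'(1)] root_point_inj[OF a nz'(1) nz'(2)]
      root_point_inj[OF a nz'(2) nz(1)] d
      quad_root_point[OF a r \<beta>] quad_root_point[OF a next_root(1)[OF r] \<beta>, unfolded s]
      quad_root_point[OF a next_root(2)[OF r] \<beta>, unfolded s] by blast
qed

lemma cyclic_class_root_triple:
  assumes r: "poly (Q \<beta>) r = 0"
  shows "cyclic_class (root_triple a b \<beta> r) = root_triple a b \<beta> ` {t. poly (Q \<beta>) t = 0}"
proof -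
  have nz: "r \<noteq> 0" "r + 1 \<noteq> 0" using r by (auto simp: Q_root_iff)
  show ?thesis unfolding Q_roots[OF r] image_insert image_empty root_triple_def next_root_simps[OF nz]
    by (simp add: cyclic_class_def)
qed

lemma cycle_points_root_triples:
  assumes r: "poly (Q \<beta>) r = 0"
  shows "cycle_points (root_triple a b \<beta> ` {t. poly (Q \<beta>) t = 0})
    = root_point a b \<beta> ` {t. poly (Q \<beta>) t = 0}"
proof -
  have "cycle_points (cyclic_class (root_triple a b \<beta> r))
      = root_point a b \<beta> ` {r, - (r + 1) / r, - 1 / (r + 1)}"
    unfolding root_triple_def cyclic_class_def cycle_points_def by auto
  then show ?thesis unfolding cyclic_class_root_triple[OF r] Q_roots[OF r, symmetric] .
qed

lemma q_image:
  assumes r: "poly (Q \<beta>) r = 0"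
  shows "q \<beta> ` {1, 2, 3} = {t. poly (Q \<beta>) t = 0}"
proof -
  let ?R = "{t. poly (Q \<beta>) t = 0}"
  have nz: "r \<noteq> 0" "r + 1 \<noteq> 0" using r by (auto simp: Q_root_iff)
  have fin: "finite ?R" unfolding Q_roots[OF r] by simp
  have "card ?R = 3" unfolding Q_roots[OF r] using roots_distinct[OF nz] by simp
  then have len: "length (sorted_list_of_set ?R) = 3" by simp
  have "q \<beta> ` {1, 2, 3} = (!) (sorted_list_of_set ?R) ` {0, 1, 2}" by (simp add: q_def)
  also have "{0, 1, 2} = {0..<length (sorted_list_of_set ?R)}" unfolding len by auto
  also have "(!) (sorted_list_of_set ?R) ` \<dots> = ?R"
    using fin by (simp add: nth_image[of _ "sorted_list_of_set ?R", simplified])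
  finally show ?thesis .
qed

text \<open>A 3-cycle is determined by its set of points, since the map fixes their cyclic order.\<close>

lemma three_cycle_points_inj:
  assumes "is_three_cycle g C" "is_three_cycle g D" "cycle_points C = cycle_points D"
  shows "C = D"
proof -
  obtain x y z where C: "is_rep3 g (x, y, z)" "C = cyclic_class (x, y, z)"
    using assms(1) by (auto simp: is_three_cycle_def)
  obtain u v w where D: "is_rep3 g (u, v, w)" "D = cyclic_class (u, v, w)"
    using assms(2) by (auto simp: is_three_cycle_def)
  have "cycle_points C = {x, y, z}" "cycle_points D = {u, v, w}"
    unfolding C D by (auto simp: cycle_points_def cyclic_class_def)
  then have "u \<in> {x, y, z}" using assms(3) by auto
  moreover have "g x = y" "g y = z" "g z = x" "g u = v" "g v = w"
    using C D by (auto simp: is_rep3_def)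
  ultimately show ?thesis unfolding C D by (auto simp: cyclic_class_def)
qed

lemma C_delta_eq:
  assumes a: "a \<noteq> 0" and \<delta>: "delta a b c > 0"
  defines "\<beta> \<equiv> sqrt (delta a b c)"
  shows "C_delta a b c = root_triple a b \<beta> ` {t. poly (Q \<beta>) t = 0}"
proof -
  have \<beta>0: "\<beta> > 0" and \<beta>2: "\<beta>\<^sup>2 = delta a b c" using \<delta> by (auto simp: \<beta>_def)
  obtain r where r: "poly (Q \<beta>) r = 0" using Q_root_exists[OF \<beta>0] by blast
  let ?R = "{t. poly (Q \<beta>) t = 0}"
  let ?C = "root_triple a b \<beta> ` ?R"
  have cyc: "is_three_cycle (quad a b c) ?C"
    unfolding is_three_cycle_def using is_rep3_root_triple[OF a r \<beta>2] cyclic_class_root_triple[OF r] by metis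
  have "cycle_points ?C = root_point a b \<beta> ` ?R" by (rule cycle_points_root_triples[OF r])
  also have "\<dots> = {(- b + \<beta> + 1) / (2 * a) + 1 / (a * q \<beta> i) | i. i \<in> {1, 2, 3}}"
    unfolding q_image[OF r, symmetric] root_point_def by (simp only: image_image Setcompr_eq_image)
  finally have pts: "cycle_points ?C = \<dots>" .
  show ?thesis unfolding C_delta_def \<beta>_def[symmetric]
  proof (rule the_equality, intro conjI)
    fix C assume "is_three_cycle (quad a b c) C \<and> cycle_points C
      = {(- b + \<beta> + 1) / (2 * a) + 1 / (a * q \<beta> i) | i. i \<in> {1, 2, 3}}"
    then show "C = ?C" using three_cycle_points_inj[OF _ cyc] pts by metis
  qed (fact cyc pts)+
qed

lemma root_triple_multiplier:
  assumes r: "poly (Q \<beta>) r = 0"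
  shows "(\<beta> + 1 + 2 / r) * (\<beta> + 1 + 2 / (- (r + 1) / r)) * (\<beta> + 1 + 2 / (- 1 / (r + 1)))
    = 1 - (\<beta> ^ 3 + \<beta>\<^sup>2 + 7 * \<beta>)"
proof -
  have nz: "r \<noteq> 0" "r + 1 \<noteq> 0" and \<beta>r: "\<beta> = ratio_param r" using r by (auto simp: Q_root_iff)
  define i w where iw: "i = 1 / r" "w = 1 / (r + 1)"
  have i: "r * i = 1" "(r + 1) * w = 1" using nz by (simp_all add: iw)
  have e: "2 / r = 2 * i" "2 / (- (r + 1) / r) = 2 * w - 2" "2 / (- 1 / (r + 1)) = - 2 * (r + 1)"
    using nz unfolding iw by (simp_all add: divide_simps, (simp_all add: algebra_simps)?)
  have "\<beta> = r - i - w" by (simp add: \<beta>r ratio_param_def iw)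
  then show ?thesis unfolding e using i by algebra
qed

lemma root_triple_ratio:
  assumes a: "a \<noteq> 0" and r: "poly (Q \<beta>) r = 0" and xyz: "(x, y, z) = root_triple a b \<beta> r"
  shows "(z - y) / (y - x) = r"
proof -
  have nz: "r \<noteq> 0" "r + 1 \<noteq> 0" using r by (auto simp: Q_root_iff)
  have nz': "- (r + 1) / r \<noteq> 0" using next_root(1)[OF r] by (auto simp: Q_root_iff)
  have "x = root_point a b \<beta> r" "y = root_point a b \<beta> (- (r + 1) / r)"
    using xyz by (simp_all add: root_triple_def)
  then have "y \<noteq> x" using root_point_inj[OF a nz(1) nz'] roots_distinct(1)[OF nz] by metis
  define i w where iw: "i = 1 / r" "w = 1 / (r + 1)"
  have i: "r * i = 1" "(r + 1) * w = 1" using nz by (simp_all add: iw)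
  have e: "2 / r = 2 * i" "2 / (- (r + 1) / r) = 2 * w - 2" "2 / (- 1 / (r + 1)) = - 2 * (r + 1)"
    using nz unfolding iw by (simp_all add: divide_simps, (simp_all add: algebra_simps)?)
  have "2 * a * x + b = \<beta> + 1 + 2 * i" "2 * a * y + b = \<beta> + 1 + (2 * w - 2)"
    "2 * a * z + b = \<beta> + 1 + - 2 * (r + 1)"
    using xyz deriv_at_root_point[OF a] unfolding e[symmetric] root_triple_def by auto
  then have "2 * a * (z - y) = 2 * a * (r * (y - x))" using i by algebra
  then have "z - y = r * (y - x)" using a by simp
  then show ?thesis using \<open>y \<noteq> x\<close> by simp
qed

lemma asymptotically_stable_iff:
  assumes a: "a \<noteq> 0" and \<delta>: "delta a b c > 0"
  defines "\<beta> \<equiv> sqrt (delta a b c)"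
  shows "asymptotically_stable_cycle (quad a b c) (C_delta a b c) \<longleftrightarrow> \<beta> ^ 3 + \<beta>\<^sup>2 + 7 * \<beta> \<le> 2"
proof -
  have \<beta>0: "\<beta> > 0" and \<beta>2: "\<beta>\<^sup>2 = delta a b c" using \<delta> by (auto simp: \<beta>_def)
  let ?g = "quad a b c"
  let ?st = "\<lambda>x. lyapunov_stable3 ?g x \<and>
    (\<exists>\<gamma>>0. \<forall>x0. \<bar>x0 - x\<bar> < \<gamma> \<longrightarrow> (\<lambda>t. (?g ^^ (3 * t)) x0) \<longlonglongrightarrow> x)"
  have st: "?st (root_point a b \<beta> r) \<longleftrightarrow> \<beta> ^ 3 + \<beta>\<^sup>2 + 7 * \<beta> \<le> 2" if r: "poly (Q \<beta>) r = 0" for r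
  proof -
    note rep = is_rep3_root_triple[OF a r \<beta>2, unfolded root_triple_def]
    note m = root_triple_multiplier[OF r]
    have "\<beta> ^ 3 + \<beta>\<^sup>2 + 7 * \<beta> > 0" using \<beta>0 by (intro add_pos_pos) auto
    then have lt: "(\<beta> + 1 + 2 / r) * (\<beta> + 1 + 2 / (- (r + 1) / r)) * (\<beta> + 1 + 2 / (- 1 / (r + 1))) < 1"
      unfolding m by simp
    show ?thesis
      unfolding stability_conjugate[OF a rep] deriv_at_root_point[OF a] return_dev_stability[OF lt]
      unfolding m by auto
  qed
  obtain r where r: "poly (Q \<beta>) r = 0" using Q_root_exists[OF \<beta>0] by blast
  have pts: "cycle_points (C_delta a b c) = root_point a b \<beta> ` {t. poly (Q \<beta>) t = 0}"
    unfolding C_delta_eq[OF a \<delta>] \<beta>_def[symmetric] by (rule cycle_points_root_triples[OF r])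
  show ?thesis unfolding asymptotically_stable_cycle_def pts using st r by blast
qed

lemma digits3_pos:
  fixes u d :: real and n :: int
  assumes "0 < u" "n \<le> 1000 * u" "1000 * u < n + 1" "d = n / 1000"
  shows "digits3 u d"
proof -
  have "\<lfloor>1000 * u\<rfloor> = n" using assms by (intro floor_unique) auto
  then show ?thesis using assms by (simp add: digits3_def)
qed

lemma digits3_neg:
  fixes u d :: real and n :: int
  assumes "u < 0" "n \<le> - 1000 * u" "- 1000 * u < n + 1" "d = - (n / 1000)"
  shows "digits3 u d"
proof -
  have "\<lfloor>1000 * \<bar>u\<bar>\<rfloor> = n" using assms by (intro floor_unique) auto
  then show ?thesis using assms by (simp add: digits3_def)
qed

lemma ratio_param_IVT:
  assumes "l < u" "l * u > 0" "(l + 1) * (u + 1) > 0" "ratio_param l < \<beta>" "\<beta> < ratio_param u"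
  shows "\<exists>r. l < r \<and> r < u \<and> ratio_param r = \<beta>"
proof -
  have "t \<noteq> 0 \<and> t + 1 \<noteq> 0" if "l \<le> t" "t \<le> u" for t
    using assms(2,3) that by (auto simp: zero_less_mult_iff)
  then have "continuous_on {l..u} ratio_param"
    unfolding ratio_param_def[abs_def] by (intro continuous_intros) auto
  then obtain r where "l \<le> r" "r \<le> u" "ratio_param r = \<beta>"
    using IVT'[of ratio_param l \<beta> u] assms by auto
  then show ?thesis using assms by (intro exI[of _ r]) (auto simp: less_le)
qed

theorem theorem2p7:
  "\<exists>l1 u1 l2 u2 l3 u3 :: real.
     digits3 l1 (-1.801) \<and> digits3 u1 (-1.713) \<and>
     digits3 l2 (-0.445) \<and> digits3 u2 (-0.416) \<and>
     digits3 l3 1.246 \<and> digits3 u3 1.401 \<and>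
     (\<forall>a b c x y z r :: real.
        a \<noteq> 0 \<longrightarrow> delta a b c > 0 \<longrightarrow> (x, y, z) \<in> C_delta a b c \<longrightarrow> r = (z - y) / (y - x) \<longrightarrow>
        (asymptotically_stable_cycle (quad a b c) (C_delta a b c) \<longleftrightarrow>
         r \<in> {l1<..u1} \<union> {l2<..u2} \<union> {l3<..u3}))"
proof -
  let ?p = "\<lambda>\<beta>::real. \<beta> ^ 3 + \<beta>\<^sup>2 + 7 * \<beta>"
  have "continuous_on {0.2722..0.2723} ?p" by (intro continuous_intros)
  then obtain \<beta>0 where \<beta>0: "0.2722 \<le> \<beta>0" "\<beta>0 \<le> 0.2723" "?p \<beta>0 = 2"
    using IVT'[of ?p "0.2722" 2 "0.2723"] by (auto simp: power2_eq_square power3_eq_cube)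
  obtain l1 where l1: "-1.802 < l1" "l1 < -1.801" "ratio_param l1 = 0"
    using ratio_param_IVT[of "-1.802" "-1.801" 0] by (auto simp: ratio_param_def)
  obtain l2 where l2: "-0.446 < l2" "l2 < -0.445" "ratio_param l2 = 0"
    using ratio_param_IVT[of "-0.446" "-0.445" 0] by (auto simp: ratio_param_def)
  obtain l3 where l3: "1.246 < l3" "l3 < 1.247" "ratio_param l3 = 0"
    using ratio_param_IVT[of "1.246" "1.247" 0] by (auto simp: ratio_param_def)
  obtain u1 where u1: "-1.714 < u1" "u1 < -1.713" "ratio_param u1 = \<beta>0"
    using ratio_param_IVT[of "-1.714" "-1.713" \<beta>0] \<beta>0 by (auto simp: ratio_param_def)
  obtain u2 where u2: "-0.417 < u2" "u2 < -0.416" "ratio_param u2 = \<beta>0"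
    using ratio_param_IVT[of "-0.417" "-0.416" \<beta>0] \<beta>0 by (auto simp: ratio_param_def)
  obtain u3 where u3: "1.401 < u3" "u3 < 1.402" "ratio_param u3 = \<beta>0"
    using ratio_param_IVT[of "1.401" "1.402" \<beta>0] \<beta>0 by (auto simp: ratio_param_def)
  have mono: "?p s < ?p t" if "0 < s" "s < t" for s t :: real
    using that by (intro add_strict_mono power_strict_mono) auto
  have interval: "r \<in> {l<..u} \<longleftrightarrow> 0 < ratio_param r \<and> ratio_param r \<le> \<beta>0"
    if "r * l > 0" "(r + 1) * (l + 1) > 0" "r * u > 0" "(r + 1) * (u + 1) > 0"
      "ratio_param l = 0" "ratio_param u = \<beta>0" for r l u
  proof -
    have "0 < ratio_param r \<longleftrightarrow> l < r" using ratio_param_less_iff[of r l] that by simp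
    moreover have "\<beta>0 < ratio_param r \<longleftrightarrow> u < r" using ratio_param_less_iff[of r u] that by simp
    ultimately show ?thesis by auto
  qed
  have key: "r \<in> {l1<..u1} \<union> {l2<..u2} \<union> {l3<..u3} \<longleftrightarrow> 0 < ratio_param r \<and> ratio_param r \<le> \<beta>0"
    if nz: "r \<noteq> 0" "r \<noteq> -1" for r
  proof -
    consider "r < -1" | "-1 < r" "r < 0" | "0 < r" using nz by linarith
    then show ?thesis
    proof cases
      case 1
      then have "r \<in> {l1<..u1} \<longleftrightarrow> 0 < ratio_param r \<and> ratio_param r \<le> \<beta>0"
        using l1 u1 by (intro interval) (auto simp: zero_less_mult_iff)
      moreover have "r \<notin> {l2<..u2}" "r \<notin> {l3<..u3}" using 1 l2 l3 by auto
      ultimately show ?thesis by blast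
    next
      case 2
      then have "r \<in> {l2<..u2} \<longleftrightarrow> 0 < ratio_param r \<and> ratio_param r \<le> \<beta>0"
        using l2 u2 by (intro interval) (auto simp: zero_less_mult_iff)
      moreover have "r \<notin> {l1<..u1}" "r \<notin> {l3<..u3}" using 2 u1 l3 by auto
      ultimately show ?thesis by blast
    next
      case 3
      then have "r \<in> {l3<..u3} \<longleftrightarrow> 0 < ratio_param r \<and> ratio_param r \<le> \<beta>0"
        using l3 u3 by (intro interval) (auto simp: zero_less_mult_iff)
      moreover have "r \<notin> {l1<..u1}" "r \<notin> {l2<..u2}" using 3 u1 u2 by auto
      ultimately show ?thesis by blast
    qed
  qed
  have main: "asymptotically_stable_cycle (quad a b c) (C_delta a b c) \<longleftrightarrow>
       r \<in> {l1<..u1} \<union> {l2<..u2} \<union> {l3<..u3}"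
    if a: "a \<noteq> 0" and \<delta>: "delta a b c > 0" and xyz: "(x, y, z) \<in> C_delta a b c"
      and r: "r = (z - y) / (y - x)" for a b c x y z r
  proof -
    let ?\<beta> = "sqrt (delta a b c)"
    obtain t where t: "poly (Q ?\<beta>) t = 0" "(x, y, z) = root_triple a b ?\<beta> t"
      using xyz unfolding C_delta_eq[OF a \<delta>] by auto
    have "r = t" unfolding r by (rule root_triple_ratio[OF a t])
    then have root: "r \<noteq> 0" "r \<noteq> -1" "ratio_param r = ?\<beta>" using t(1) by (auto simp: Q_root_iff)
    have pos: "?\<beta> > 0" using \<delta> by simp
    have "?p ?\<beta> \<le> 2 \<longleftrightarrow> ?\<beta> \<le> \<beta>0"
    proof
      assume "?p ?\<beta> \<le> 2"
      then show "?\<beta> \<le> \<beta>0" using mono[of \<beta>0 ?\<beta>] \<beta>0 by (intro leI notI) auto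
    next
      assume "?\<beta> \<le> \<beta>0"
      then show "?p ?\<beta> \<le> 2" using mono[OF pos, of \<beta>0] \<beta>0(3) by (cases "?\<beta> = \<beta>0") auto
    qed
    then show ?thesis unfolding asymptotically_stable_iff[OF a \<delta>] key[OF root(1,2)] root(3)
      using pos by simp
  qed
  have dg: "digits3 l1 (-1.801)" "digits3 u1 (-1.713)" "digits3 l2 (-0.445)" "digits3 u2 (-0.416)"
    "digits3 l3 1.246" "digits3 u3 1.401"
    using l1 l2 l3 u1 u2 u3 digits3_neg[of l1 1801] digits3_neg[of u1 1713] digits3_neg[of l2 445]
      digits3_neg[of u2 416] digits3_pos[of l3 1246] digits3_pos[of u3 1401] by simp_all
  show ?thesis using dg main by blast
qed

end
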